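(* Let $p$ be an odd prime and $r\ge1$ an integer. The least period of the sequence $(H_{r-1}(u))_{u\ge0}$ is $p^{r+1}$.
   Context: Let $\varphi$ be Euler's totient function. For an integer $r\ge1$, the Euler quotient $Q_r(u)$ is the unique integer with $0\le Q_r(u)<p^r$ and $Q_r(u)\equiv \frac{u^{\varphi(p^r)}-1}{p^r}\pmod{p^r}$ when $\gcd(u,p)=1$; and $Q_r(u)=0$ when $p\mid u$. One has $Q_r(u)\equiv Q_{r-1}(u)\pmod{p^{r-1}}$ for $r\ge2$. Define $H_0(u)=Q_1(u)$ and, for $r\ge2$, $H_{r-1}(u)$ as the unique integer with $0\le H_{r-1}(u)<p$ and $H_{r-1}(u)\equiv \frac{Q_r(u)-Q_{r-1}(u)}{p^{r-1}}\pmod p$ (the highest $p$-adic digit of $Q_r(u)$). *)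

theory Defs
  imports "HOL-Number_Theory.Number_Theory"
begin

definition euler_quotient :: "nat \<Rightarrow> nat \<Rightarrow> nat \<Rightarrow> int" where
  "euler_quotient p r u =
     (if coprime u p
      then ((int u ^ totient (p ^ r) - 1) div int p ^ r) mod int p ^ r
      else 0)"

text \<open>
  \<open>euler_digit p i\<close> is \<open>H\<^sub>i\<close>, where \<open>i = r - 1\<close>.  The divisions here and in the
  Euler quotient are exact, see the lemmas below.
\<close>

fun euler_digit :: "nat \<Rightarrow> nat \<Rightarrow> nat \<Rightarrow> int" where
  "euler_digit p 0 u = euler_quotient p 1 u"
| "euler_digit p (Suc i) u =
     ((euler_quotient p (i + 2) u - euler_quotient p (i + 1) u) div int p ^ (i + 1)) mod int p"

definition is_period :: "(nat \<Rightarrow> 'a) \<Rightarrow> nat \<Rightarrow> bool" where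
  "is_period f T \<longleftrightarrow> T > 0 \<and> (\<forall>u. f (u + T) = f u)"

definition is_least_period :: "(nat \<Rightarrow> 'a) \<Rightarrow> nat \<Rightarrow> bool" where
  "is_least_period f T \<longleftrightarrow> is_period f T \<and> (\<forall>T'. is_period f T' \<longrightarrow> T \<le> T')"

lemma euler_quotient_exact:
  assumes "coprime u p"
  shows "int p ^ r dvd int u ^ totient (p ^ r) - 1"
proof -
  have "[u ^ totient (p ^ r) = 1] (mod p ^ r)"
    by (rule euler_theorem) (use assms in simp)
  then have "[int (u ^ totient (p ^ r)) = int 1] (mod int (p ^ r))"
    by (simp only: cong_int_iff)
  then show ?thesis
    by (simp add: cong_iff_dvd_diff)
qed

lemma euler_quotient_unique:
  assumes "prime p" "coprime u p"
  shows "q = euler_quotient p r u \<longleftrightarrow>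
    0 \<le> q \<and> q < int p ^ r \<and> [q = (int u ^ totient (p ^ r) - 1) div int p ^ r] (mod int p ^ r)"
proof -
  have "int p ^ r > 0" using assms(1) by (simp add: prime_gt_0_nat)
  then show ?thesis
    using assms(2) by (auto simp: euler_quotient_def cong_def)
qed

lemma euler_quotient_eq_0: "prime p \<Longrightarrow> p dvd u \<Longrightarrow> euler_quotient p r u = 0"
  by (auto simp: euler_quotient_def dest: coprime_common_divisor)

lemma one_plus_power_cong:
  fixes a :: int
  shows "a ^ 3 dvd (1 + a) ^ n - (1 + int n * a + int (n choose 2) * a ^ 2)"
proof (induction n)
  case 0
  show ?case by (simp add: numeral_2_eq_2)
next
  case (Suc n)
  then obtain k where k: "(1 + a) ^ n = 1 + int n * a + int (n choose 2) * a ^ 2 + a ^ 3 * k"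
    by (metis dvdE diff_add_cancel add.commute)
  have c: "Suc n choose 2 = n + (n choose 2)"
    by (simp add: numeral_2_eq_2)
  have "(1 + a) ^ Suc n - (1 + int (Suc n) * a + int (Suc n choose 2) * a ^ 2)
      = a ^ 3 * (k + a * k + int (n choose 2))"
    unfolding c power_Suc k by (simp add: algebra_simps power2_eq_square power3_eq_cube)
  then show ?case by simp
qed

lemma euler_quotient_cong:
  assumes p: "prime p" "odd p" and r: "r \<ge> 2"
  shows "[euler_quotient p r u = euler_quotient p (r - 1) u] (mod int p ^ (r - 1))"
proof (cases "coprime u p")
  case False
  then show ?thesis by (simp add: euler_quotient_def)
next
  case True
  obtain s where s: "r = Suc s" "s \<ge> 1" using r by (cases r) auto
  define P where "P = int p"
  have P0: "P \<noteq> 0" using p(1) by (auto simp: P_def)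
  have tot: "totient (p ^ r) = p * totient (p ^ s)"
    unfolding s(1) using p(1) s(2)
    by (cases s) (simp_all only: totient_prime_power_Suc, simp_all)
  obtain q where q: "int u ^ totient (p ^ s) - 1 = P ^ s * q"
    using euler_quotient_exact[OF True, of s] unfolding P_def by (auto elim: dvdE)
  define a where "a = P ^ s * q"
  have uq: "int u ^ totient (p ^ r) = (1 + a) ^ p"
    unfolding tot using q by (simp add: a_def power_mult mult.commute[of p] flip: q)
  obtain k where k: "(1 + a) ^ p = 1 + P * a + int (p choose 2) * a ^ 2 + a ^ 3 * k"
    using one_plus_power_cong[of a p] unfolding P_def
    by (metis dvdE diff_add_cancel add.commute)
  have "p dvd p choose 2"
    using p prime_gt_1_nat[OF p(1)]
    by (intro dvd_choose_prime) (auto intro: le_neq_trans)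
  then obtain c where c: "int (p choose 2) = P * c"
    unfolding P_def by (metis dvdE of_nat_mult)
  obtain t where t: "s = Suc t" using s by (cases s) auto
  have "int u ^ totient (p ^ r) - 1 = P ^ r * (q + P ^ s * (c * q ^ 2 + P ^ t * q ^ 3 * k))"
    unfolding uq k c by (simp add: a_def s(1) t algebra_simps power2_eq_square power3_eq_cube)
  then have 1: "(int u ^ totient (p ^ r) - 1) div P ^ r = q + P ^ s * (c * q ^ 2 + P ^ t * q ^ 3 * k)"
    using P0 by simp
  have 2: "(int u ^ totient (p ^ s) - 1) div P ^ s = q"
    using q P0 by simp
  have "P ^ s dvd P ^ r" by (simp add: s)
  then have "[euler_quotient p r u = q] (mod P ^ s)"
    using True 1 by (simp add: euler_quotient_def cong_def mod_mod_cancel flip: P_def)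
  moreover have "[euler_quotient p s u = q] (mod P ^ s)"
    using True 2 by (simp add: euler_quotient_def cong_def flip: P_def)
  ultimately show ?thesis
    by (simp add: s cong_def P_def)
qed

end

theory Submission
  imports Defs
begin

text \<open>
  For \<open>u\<close> coprime to \<open>p\<close>, expanding \<open>(u + k p\<^sup>r)\<^bsup>\<phi>(p\<^sup>r)\<^esup>\<close> to first order gives
  \<open>Q\<^sub>r(u + k p\<^sup>r) \<equiv> Q\<^sub>r(u) + k \<phi>(p\<^sup>r) u\<^bsup>\<phi>(p\<^sup>r) - 1\<^esup> (mod p\<^sup>r)\<close>.  As \<open>p\<^sup>r\<close> divides \<open>p \<phi>(p\<^sup>r)\<close>, the
  sequence \<open>Q\<^sub>r\<close> has period \<open>p\<^bsup>r+1\<^esup>\<close>, and so has \<open>H\<^bsub>r-1\<^esub>\<close>.  The periods of a sequence are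
  closed under gcd, so a smaller period would make \<open>p\<^sup>r\<close> a period; but \<open>H\<^bsub>r-1\<^esub>(1) = 0\<close>, whereas
  \<open>Q\<^sub>r(1 + p\<^sup>r) = \<phi>(p\<^sup>r)\<close> has highest digit \<open>p - 1\<close>.
\<close>

lemma power_add_first_order:
  fixes x y :: "'a::comm_ring_1"
  shows "y\<^sup>2 dvd (x + y) ^ n - (x ^ n + of_nat n * x ^ (n - 1) * y)"
proof (induction n)
  case 0
  show ?case by simp
next
  case (Suc n)
  then obtain c where c: "(x + y) ^ n = x ^ n + of_nat n * x ^ (n - 1) * y + y\<^sup>2 * c"
    by (metis dvdE diff_add_cancel add.commute)
  \<comment> \<open>At \<open>n = 0\<close>, where \<open>n - 1\<close> truncates, the factor
    \<open>of_nat n\<close> rescues the identity.\<close>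
  have x: "of_nat n * (x * x ^ (n - 1)) = of_nat n * x ^ n"
    by (cases n) simp_all
  have "(x + y) ^ Suc n - (x ^ Suc n + of_nat (Suc n) * x ^ (Suc n - 1) * y)
      = (of_nat n * (x * x ^ (n - 1)) - of_nat n * x ^ n) * y
        + y\<^sup>2 * (of_nat n * x ^ (n - 1) + (x + y) * c)"
    unfolding power_Suc c by (simp add: algebra_simps power2_eq_square)
  then show ?case unfolding x by simp
qed

lemma is_period_add_mult:
  assumes "is_period f T"
  shows "f (u + k * T) = f u"
proof (induction k)
  case (Suc k)
  have "f (u + Suc k * T) = f ((u + k * T) + T)"
    by (simp add: algebra_simps)
  with Suc assms show ?case by (simp add: is_period_def)
qed simp

text \<open>By Bezout some multiple of \<open>S\<close> exceeds a multiple of \<open>T\<close> by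
  \<open>gcd S T\<close>, so a shift by the gcd followed by \<open>T\<close>-steps amounts to
  \<open>S\<close>-steps.\<close>

lemma is_period_gcd:
  assumes S: "is_period f S" and T: "is_period f T"
  shows "is_period f (gcd S T)"
proof -
  have "S \<noteq> 0" using S by (simp add: is_period_def)
  then obtain x y where xy: "S * x = T * y + gcd S T"
    using bezout_nat by blast
  have "f (u + gcd S T) = f u" for u
  proof -
    have "f (u + gcd S T) = f (u + gcd S T + y * T)"
      using is_period_add_mult[OF T] by simp
    also have "u + gcd S T + y * T = u + x * S"
      using xy by (simp add: algebra_simps)
    finally show ?thesis using is_period_add_mult[OF S] by simp
  qed
  then show ?thesis using \<open>S \<noteq> 0\<close> by (simp add: is_period_def)
qed

lemma is_period_dvd:
  assumes "is_period f S" "S dvd T" "T > 0"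
  shows "is_period f T"
  using assms is_period_add_mult[OF assms(1)]
  by (auto simp: is_period_def mult.commute elim!: dvdE)

text \<open>For a period \<open>T\<close>, \<open>gcd T (p ^ Suc n)\<close> is a period and a power
  of \<open>p\<close>; an exponent at most \<open>n\<close> would make \<open>p ^ n\<close> a
  period.\<close>

lemma is_least_period_prime_power:
  fixes p n :: nat
  assumes p: "prime p" and per: "is_period f (p ^ Suc n)" and nper: "\<not> is_period f (p ^ n)"
  shows "is_least_period f (p ^ Suc n)"
  unfolding is_least_period_def
proof (intro conjI allI impI per)
  fix T assume T: "is_period f T"
  have g: "is_period f (gcd T (p ^ Suc n))"
    by (rule is_period_gcd[OF T per])
  obtain j where j: "j \<le> Suc n" "gcd T (p ^ Suc n) = p ^ j"
    using divides_primepow_nat[OF p] by (metis gcd_dvd2)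
  have "\<not> j \<le> n"
    using is_period_dvd[of f "p ^ j" "p ^ n"] g j(2) nper p
    by (auto simp: le_imp_power_dvd prime_gt_0_nat)
  then have "p ^ Suc n dvd T"
    using j by (metis gcd_dvd1 le_Suc_eq)
  then show "p ^ Suc n \<le> T"
    using T by (auto simp: is_period_def intro: dvd_imp_le)
qed

text \<open>The second-order term carries \<open>p ^ (2 * r)\<close>, so it still vanishes modulo
  \<open>p ^ r\<close> after the division by \<open>p ^ r\<close>.\<close>

lemma euler_quotient_add_mult:
  assumes p: "prime p" and u: "coprime u p" and "r > 0"
  shows "euler_quotient p r (u + k * p ^ r) =
    (euler_quotient p r u + int k * int (totient (p ^ r)) * int u ^ (totient (p ^ r) - 1)) mod int p ^ r"
proof -
  define m where "m = int p ^ r"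
  define t where "t = totient (p ^ r)"
  have m0: "m \<noteq> 0" using p by (auto simp: m_def)
  \<comment> \<open>Since \<open>r > 0\<close>, the shift is a multiple of \<open>p\<close>.\<close>
  have cop: "coprime (u + k * p ^ r) p"
  proof -
    have "k * p ^ r = (k * p ^ (r - 1)) * p"
      using \<open>r > 0\<close> by (cases r) simp_all
    then show ?thesis
      using u by (metis coprime_iff_gcd_eq_1 gcd.commute gcd_add_mult add.commute)
  qed
  obtain q where q: "int u ^ t - 1 = m * q"
    using euler_quotient_exact[OF u, of r] by (auto simp: m_def t_def elim: dvdE)
  obtain c where c: "(int u + int k * m) ^ t
      = int u ^ t + int t * int u ^ (t - 1) * (int k * m) + (int k * m)\<^sup>2 * c"
    using power_add_first_order[of "int k * m" "int u" t]
    by (metis dvdE diff_add_cancel add.commute)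
  have "int (u + k * p ^ r) ^ t - 1 =
      m * (q + int k * int t * int u ^ (t - 1) + m * ((int k)\<^sup>2 * c))"
  proof -
    have "int (u + k * p ^ r) ^ t = (int u + int k * m) ^ t" by (simp add: m_def)
    also have "\<dots> = (1 + m * q) + int t * int u ^ (t - 1) * (int k * m) + (int k * m)\<^sup>2 * c"
      unfolding c using q by simp
    finally show ?thesis by (simp add: algebra_simps power2_eq_square)
  qed
  then have "(int (u + k * p ^ r) ^ t - 1) div m =
      q + int k * int t * int u ^ (t - 1) + m * ((int k)\<^sup>2 * c)"
    using m0 by simp
  moreover have "(int u ^ t - 1) div m = q" using q m0 by simp
  ultimately show ?thesis
    using u cop unfolding euler_quotient_def
    by (simp add: mod_add_left_eq flip: m_def t_def)
qed

lemma is_period_euler_quotient: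
  assumes p: "prime p"
  shows "is_period (euler_quotient p r) (p ^ Suc r)"
proof -
  have "euler_quotient p r (u + p ^ Suc r) = euler_quotient p r u" for u
  proof (cases "coprime u p \<and> r > 0")
    case True
    then obtain s where s: "r = Suc s" by (cases r) auto
    \<comment> \<open>Both sides are explicit:
      \<open>p * totient (p ^ r) = p ^ r * (p - 1)\<close>.\<close>
    have "int p ^ r dvd int p * int (totient (p ^ r))"
      using p by (simp add: s totient_prime_power_Suc del: power_Suc)
        (simp add: mult.assoc)
    then have "int p ^ r dvd int p * int (totient (p ^ r)) * int u ^ (totient (p ^ r) - 1)"
      by (rule dvd_mult2)
    then obtain c where c:
      "int p * int (totient (p ^ r)) * int u ^ (totient (p ^ r) - 1) = int p ^ r * c" ..
    show ?thesis
      using euler_quotient_add_mult[OF p, of u r p] True c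
      by (simp add: euler_quotient_def)
  next
    \<comment> \<open>Without coprimality both values are 0 by definition; for \<open>r = 0\<close>
      they are residues modulo 1.\<close>
    case False
    have "coprime (u + p ^ Suc r) p \<longleftrightarrow> coprime u p"
      by (metis coprime_iff_gcd_eq_1 gcd.commute gcd_add_mult add.commute power_Suc2)
    with False show ?thesis by (auto simp: euler_quotient_def)
  qed
  then show ?thesis using p by (simp add: is_period_def prime_gt_0_nat)
qed

text \<open>At \<open>i = 0\<close> this holds because \<open>euler_quotient p 0\<close> is a residue modulo \<open>1\<close>, hence zero.\<close>

lemma euler_digit_eq:
  "euler_digit p i u =
    ((euler_quotient p (Suc i) u - euler_quotient p i u) div int p ^ i) mod int p"
  by (cases i) (simp_all add: euler_quotient_def)

lemma is_period_euler_digit: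
  assumes p: "prime p"
  shows "is_period (euler_digit p i) (p ^ Suc (Suc i))"
proof -
  have "is_period (euler_quotient p i) (p ^ Suc (Suc i))"
    using is_period_dvd[OF is_period_euler_quotient[OF p]] p by (simp add: prime_gt_0_nat)
  then show ?thesis
    using is_period_euler_quotient[OF p, of "Suc i"]
    unfolding is_period_def euler_digit_eq by simp
qed

lemma not_is_period_euler_digit:
  assumes p: "prime p"
  shows "\<not> is_period (euler_digit p i) (p ^ Suc i)"
proof
  assume per: "is_period (euler_digit p i) (p ^ Suc i)"
  have p1: "int p > 1" using p prime_gt_1_nat by auto
  have one: "euler_quotient p s 1 = 0" for s
    by (simp add: euler_quotient_def)
  have tot: "int (totient (p ^ Suc i)) = int p ^ i * (int p - 1)"
    using p prime_gt_0_nat[OF p]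
    by (simp add: totient_prime_power_Suc of_nat_diff del: power_Suc)
  \<comment> \<open>The bounds show that reducing modulo \<open>p ^ Suc i\<close> leaves this value
    unchanged.\<close>
  have "int p ^ i * (int p - 1) < int p ^ Suc i"
    using p1 by (simp add: mult.commute)
  moreover have "0 \<le> int p ^ i * (int p - 1)" using p1 by simp
  ultimately have "euler_quotient p (Suc i) (1 + p ^ Suc i) = int p ^ i * (int p - 1)"
    using euler_quotient_add_mult[OF p, of 1 "Suc i" 1] one[of "Suc i"]
    by (simp add: tot del: power_Suc)
  \<comment> \<open>The lower quotient already has period \<open>p ^ Suc i\<close>, so only the
    upper one changes.\<close>
  moreover have "euler_quotient p i (1 + p ^ Suc i) = 0"
    using is_period_euler_quotient[OF p, of i] one[of i] unfolding is_period_def by metis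
  ultimately have "euler_digit p i (1 + p ^ Suc i) = int p - 1"
    unfolding euler_digit_eq using p1 by (simp add: zmod_minus1)
  moreover have "euler_digit p i 1 = 0"
    unfolding euler_digit_eq by (simp only: one) simp
  moreover have "euler_digit p i (1 + p ^ Suc i) = euler_digit p i 1"
    using per unfolding is_period_def by metis
  ultimately show False using p1 by simp
qed

theorem theorem2:
  fixes p r :: nat
  assumes "prime p" and "odd p" and "r \<ge> 1"
  shows "is_least_period (euler_digit p (r - 1)) (p ^ (r + 1))"
  using is_least_period_prime_power[OF \<open>prime p\<close>, of "euler_digit p (r - 1)" r]
    is_period_euler_digit[OF \<open>prime p\<close>, of "r - 1"]
    not_is_period_euler_digit[OF \<open>prime p\<close>, of "r - 1"] \<open>r \<ge> 1\<close>
  by simp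

end
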